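(* Let $r$ be the rank of $\bm{U}$ and suppose $N\ge r$. Suppose the trunk network $\bm{\phi}_0$ is a $(2m_y+1)$-layer ReLU network whose architecture is $$\vec{\bm n}_t=(d_y,4,4,\underbrace{\tilde n,\dots,\tilde n}_{(2m_y-2)\text{ times}},N),\qquad \tilde n=2\min\{N,r\}+4 .$$ Suppose also that the branch network's architecture is sufficiently large so that for any $M\in\mathbb{R}^{(N+1)\times K}$ there exists a branch parameter $\tilde\theta$ with $\bm{C}(\tilde\theta)=M$. Then $$0=\min_{\mu,\theta}\|\bm{\Phi}(\mu)\bm{C}(\theta)-\bm{U}\|_{p,p}^p .$$
   Context: $1\le p<\infty$; $\Omega_y\subset\mathbb{R}^{d_y}$ is compact; $N,K,m_x,m_y$ are positive integers with $m_y>N$. Feed-forward networks: for $\vec{\bm n}=(n_0,\dots,n_L)$, an $L$-layer network of architecture $\vec{\bm n}$ with activation $\sigma$ (applied entrywise) is the map $\mathbb{R}^{n_0}\ni x\mapsto z^L\in\mathbb{R}^{n_L}$, $z^1=W^1x+b^1$, $z^\ell=W^\ell\sigma(z^{\ell-1})+b^\ell$ for $2\le\ell\le L$, with $W^\ell\in\mathbb{R}^{n_\ell\times n_{\ell-1}}$, $b^\ell\in\mathbb{R}^{n_\ell}$; the parameters are all the $W^\ell,b^\ell$. It is a ReLU network if $\sigma(t)=\max\{t,0\}$. Branch network: $\bm{c}(\cdot;\theta)=(c_0(\cdot;\theta),\dots,c_N(\cdot;\theta))^\top:\mathbb{R}^{m_x}\to\mathbb{R}^{N+1}$, a feed-forward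 network of a fixed architecture with parameters $\theta$. Trunk network: $\bm{\phi}(\cdot;\mu)=(1,\bm{\phi}_0(\cdot;\mu))^\top:\Omega_y\to\mathbb{R}^{N+1}$, where $\bm{\phi}_0(\cdot;\mu)=(\phi_1(\cdot;\mu),\dots,\phi_N(\cdot;\mu))$ is a feed-forward network with parameters $\mu$. Data: vectors $\bm{f}_1,\dots,\bm{f}_K\in\mathbb{R}^{m_x}$ (discretized input functions), points $y_1,\dots,y_{m_y}\in\Omega_y$, and $\bm{u}_k=(u_k(y_1),\dots,u_k(y_{m_y}))^\top\in\mathbb{R}^{m_y}$ for output functions $u_1,\dots,u_K:\Omega_y\to\mathbb{R}$. Put $\bm{U}=[\bm{u}_1,\dots,\bm{u}_K]\in\mathbb{R}^{m_y\times K}$, let $\bm{\Phi}(\mu)\in\mathbb{R}^{m_y\times(N+1)}$ be the matrix with $i$-th row $\bm{\phi}^\top(y_i;\mu)$, and $\bm{C}(\theta)=[\bm{c}(\bm{f}_1;\theta),\dots,\bm{c}(\bm{f}_K;\theta)]\in\mathbb{R}^{(N+1)\times K}$. $\|\cdot\|_{p,p}$ is the entrywise matrix norm, $\|B\|_{p,p}^p=\sum_{i,j}|B_{ij}|^p$. *)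

theory Defs
  imports "HOL-Analysis.Analysis" "Jordan_Normal_Form.DL_Rank"
begin

unbundle no vec_syntax
notation Matrix.vec_index (infixl \<open>$\<close> 100)

section \<open>Feed-forward networks\<close>

text \<open>
  A parameter is the list of all weight matrices and biases of a network. Lists are indexed from
  0, so the entry with index \<open>l\<close> is the pair (W, b) of layer \<open>l + 1\<close>.
\<close>

type_synonym net_param = "(real mat \<times> real vec) list"

text \<open>
  The parameters of an architecture \<open>(n\<^sub>0, \<dots>, n\<^sub>L)\<close>, which is given as a list of length \<open>L + 1\<close>.
\<close>

definition net_params :: "nat list \<Rightarrow> net_param set" where
  "net_params ns = {\<theta>. length ns = length \<theta> + 1 \<and>
     (\<forall>l < length \<theta>. fst (\<theta> ! l) \<in> carrier_mat (ns ! (l + 1)) (ns ! l) \<and>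
                      snd (\<theta> ! l) \<in> carrier_vec (ns ! (l + 1)))}"

text \<open>
  \<open>net_layer \<sigma> \<theta> x l\<close> is \<open>z\<^sup>l\<^sup>+\<^sup>1\<close>. The activation is applied to the input of every layer except
  the first, hence not to the network's output.
\<close>

primrec net_layer :: "(real \<Rightarrow> real) \<Rightarrow> net_param \<Rightarrow> real vec \<Rightarrow> nat \<Rightarrow> real vec" where
  "net_layer \<sigma> \<theta> x 0 = fst (\<theta> ! 0) *\<^sub>v x + snd (\<theta> ! 0)"
| "net_layer \<sigma> \<theta> x (Suc l) =
     fst (\<theta> ! Suc l) *\<^sub>v map_vec \<sigma> (net_layer \<sigma> \<theta> x l) + snd (\<theta> ! Suc l)"

definition network :: "(real \<Rightarrow> real) \<Rightarrow> net_param \<Rightarrow> real vec \<Rightarrow> real vec" where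
  "network \<sigma> \<theta> x = net_layer \<sigma> \<theta> x (length \<theta> - 1)"

definition relu :: "real \<Rightarrow> real" where
  "relu t = max t 0"


section \<open>Branch and trunk networks\<close>

text \<open>
  Points of \<open>\<real>\<^sup>d\<close> are, as in \<^const>\<open>Euclidean_space\<close>, functions that vanish from index \<open>d\<close> on;
  \<open>vec d y\<close> is the corresponding vector of dimension \<open>d\<close>. Data points and input functions are
  numbered from 0.
\<close>

definition trunk :: "nat \<Rightarrow> net_param \<Rightarrow> (nat \<Rightarrow> real) \<Rightarrow> real vec" where
  "trunk d \<mu> y = vCons 1 (network relu \<mu> (vec d y))"

definition trunk_mat ::
  "nat \<Rightarrow> nat \<Rightarrow> nat \<Rightarrow> (nat \<Rightarrow> nat \<Rightarrow> real) \<Rightarrow> net_param \<Rightarrow> real mat" where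
  "trunk_mat d N m y \<mu> = mat m (N + 1) (\<lambda>(i, j). trunk d \<mu> (y i) $ j)"

definition branch_mat ::
  "(real \<Rightarrow> real) \<Rightarrow> nat \<Rightarrow> nat \<Rightarrow> (nat \<Rightarrow> real vec) \<Rightarrow> net_param \<Rightarrow> real mat" where
  "branch_mat \<sigma> N K f \<theta> = mat (N + 1) K (\<lambda>(j, k). network \<sigma> \<theta> (f k) $ j)"

definition output_mat ::
  "nat \<Rightarrow> nat \<Rightarrow> (nat \<Rightarrow> nat \<Rightarrow> real) \<Rightarrow> (nat \<Rightarrow> (nat \<Rightarrow> real) \<Rightarrow> real) \<Rightarrow> real mat" where
  "output_mat m K y u = mat m K (\<lambda>(i, k). u k (y i))"

definition entry_norm :: "real \<Rightarrow> real mat \<Rightarrow> real" where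
  "entry_norm p B = (\<Sum>i<dim_row B. \<Sum>j<dim_col B. \<bar>B $$ (i, j)\<bar> powr p) powr (1 / p)"

end

theory Submission
  imports Defs
begin

text \<open>
  Choose \<open>r\<close> columns of \<open>U\<close> that span its column space, so that \<open>U = A B\<close> where the columns of \<open>A\<close>
  are sampled from \<open>r\<close> of the output functions; coinciding sample points are then harmless. An affine
  functional that separates the sample points reduces interpolation of these \<open>r\<close> functions to
  one variable \<open>t\<close>, where every function on \<open>n\<close> points has the form \<open>\<Sum> c\<^sub>i relu (t - \<kappa>\<^sub>i)\<close> with
  \<open>n\<close> knots that depend on the points only. A deep network evaluates such sums one knot per layer,
  with the positive and the negative coefficients collected in separate neurons. The branch network
  supplies \<open>B\<close>, padded with zero rows.
\<close>

section \<open>Linear algebra: factoring a matrix through its own columns\<close>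

text \<open>A maximal independent set of columns has \<open>rank A\<close> elements, and maximality
  puts every other column into its span. Using columns of \<open>A\<close> itself as the basis,
  selected by \<open>g\<close>, makes the left factor consist of values of output functions at the
  sample points.\<close>

lemma (in vec_space) rank_factorization:
  assumes A: "A \<in> carrier_mat n nc"
  obtains g c where "\<And>j. j < rank A \<Longrightarrow> g j < nc"
    and "\<And>i k. i < n \<Longrightarrow> k < nc \<Longrightarrow> A $$ (i, k) = (\<Sum>j<rank A. c j k * A $$ (i, g j))"
proof -
  let ?P = "\<lambda>T. T \<subseteq> set (cols A) \<and> lin_indpt T"
  have "?P {}" by (simp add: lin_dep_def)
  then obtain S where S: "finite S" "maximal S ?P"
    using maximal_exists_superset[of "set (cols A)" ?P "{}"] by auto
  have rank: "rank A = card S" using rank_card_indpt[OF A S(2)] .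
  have carr: "set (cols A) \<subseteq> carrier_vec n" using A cols_dim by blast
  have S_cols: "S \<subseteq> set (cols A)" and ind: "lin_indpt S"
    using S(2) by (auto simp: maximal_def)
  have S_carr: "S \<subseteq> carrier_vec n" using S_cols carr by blast
  obtain h where h: "bij_betw h {..<card S} S"
    using ex_bij_betw_nat_finite[OF S(1)] by (auto simp: atLeast0LessThan)
  have "\<exists>l<nc. col A l = h j" if "j < card S" for j
  proof -
    have "h j \<in> set (cols A)" using bij_betwE[OF h] that S_cols by auto
    then show ?thesis using A by (auto simp: cols_def)
  qed
  then obtain g where g: "\<And>j. j < card S \<Longrightarrow> g j < nc \<and> col A (g j) = h j" by metis
  have "\<exists>a. col A k = lincomb a S" if k: "k < nc" for k
  proof -
    have "col A k \<in> set (cols A)" using A k by (auto simp: cols_def)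
    then have "col A k \<in> span S"
    proof (cases "col A k \<in> S")
      case True
      then show ?thesis using in_own_span[OF S_carr[folded module_vec_simps]] by auto
    next
      case False
      have "\<not> ?P (insert (col A k) S)"
        using S(2) False unfolding maximal_def by blast
      then have "lin_dep (insert (col A k) S)"
        using \<open>col A k \<in> set (cols A)\<close> S_cols by auto
      then show ?thesis
        using lin_dep_iff_in_span[OF _ ind _ False] S_carr carr \<open>col A k \<in> set (cols A)\<close>
        by (auto simp: module_vec_simps)
    qed
    then show ?thesis
      using finite_span[OF S(1)] S_carr by (auto simp: module_vec_simps)
  qed
  then obtain a where a: "\<And>k. k < nc \<Longrightarrow> col A k = lincomb (a k) S" by metis
  show thesis
  proof (rule that[of g "\<lambda>j k. a k (h j)"])
    fix j assume "j < rank A" then show "g j < nc" using g rank by simp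
  next
    fix i k assume ik: "i < n" "k < nc"
    have "A $$ (i, k) = lincomb (a k) S $ i" using a[OF ik(2)] A ik by (metis index_col carrier_matD)
    also have "\<dots> = (\<Sum>x\<in>S. a k x * x $ i)" by (rule lincomb_index[OF ik(1) S_carr])
    also have "\<dots> = (\<Sum>j<card S. a k (h j) * h j $ i)"
      by (rule sum.reindex_bij_betw[OF h, symmetric])
    also have "\<dots> = (\<Sum>j<card S. a k (h j) * A $$ (i, g j))"
    proof (rule sum.cong[OF refl])
      fix j assume "j \<in> {..<card S}"
      then show "a k (h j) * h j $ i = a k (h j) * A $$ (i, g j)"
        using g[of j] A ik by (metis index_col carrier_matD lessThan_iff)
    qed
    finally show "A $$ (i, k) = (\<Sum>j<rank A. a k (h j) * A $$ (i, g j))" using rank by simp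
  qed
qed

section \<open>Reduction to one variable\<close>

text \<open>Along the moment curve \<open>s \<mapsto> (1, s, s\<^sup>2, \<dots>)\<close> only finitely many
  directions fail to separate a given pair of distinct points.\<close>

lemma separating_direction:
  fixes Y :: "(nat \<Rightarrow> real) set"
  assumes "finite Y" and supp: "\<And>v i. v \<in> Y \<Longrightarrow> d \<le> i \<Longrightarrow> v i = 0"
  obtains w :: "nat \<Rightarrow> real" where "inj_on (\<lambda>v. \<Sum>b<d. w b * v b) Y"
proof -
  let ?R = "\<lambda>q. {s. (\<Sum>b\<le>d. (fst q b - snd q b) * s ^ b) = 0} :: real set"
  let ?Q = "{q \<in> Y \<times> Y. fst q \<noteq> snd q}"
  have "finite (?R q)" if "q \<in> ?Q" for q
  proof -
    from that obtain b where b: "fst q b \<noteq> snd q b" by auto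
    then have "b \<le> d" using that supp[of "fst q" b] supp[of "snd q" b] by (cases "b \<le> d") auto
    with b show ?thesis unfolding polyfun_finite_roots by auto
  qed
  then have "finite (\<Union>q\<in>?Q. ?R q)" using assms(1) by auto
  then obtain s where s: "s \<notin> (\<Union>q\<in>?Q. ?R q)"
    using ex_new_if_finite[OF infinite_UNIV_char_0] by blast
  \<comment> \<open>The root count \<open>polyfun_finite_roots\<close> sums up to and including
    \<open>d\<close>; the additional coefficient is 0 on \<open>Y\<close> by
    \<open>supp\<close>.\<close>
  have ext: "(\<Sum>b\<le>d. v b * s ^ b) = (\<Sum>b<d. s ^ b * v b)" if "v \<in> Y" for v
    using supp[OF that, of d] by (simp add: lessThan_Suc_atMost[symmetric] mult.commute)
  have "inj_on (\<lambda>v. \<Sum>b<d. s ^ b * v b) Y"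
  proof (rule inj_onI, rule ccontr)
    fix v v' assume v: "v \<in> Y" "v' \<in> Y" "v \<noteq> v'"
      and eq: "(\<Sum>b<d. s ^ b * v b) = (\<Sum>b<d. s ^ b * v' b)"
    have "s \<in> ?R (v, v')"
      using eq ext[OF v(1)] ext[OF v(2)] by (simp add: left_diff_distrib sum_subtractf)
    with s v show False by force
  qed
  then show thesis by (rule that)
qed

section \<open>ReLU sums on finite sets of reals\<close>

text \<open>The knots come before \<open>g\<close> in the quantifier order because they become
  biases shared by all outputs of the network. Points are added in increasing order: a term whose
  knot is below the new maximum, but not below any earlier point, vanishes at all earlier points, so
  its coefficient can correct the value at the new one.\<close>

lemma relu_interpolation:
  fixes T :: "real set"
  assumes "finite T"
  shows "\<exists>\<kappa>. \<forall>g. \<exists>c. \<forall>t\<in>T. g t = (\<Sum>i<card T. c i * relu (t - \<kappa> i))"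
  using assms
proof (induction T rule: finite_linorder_max_induct)
  case empty
  then show ?case by simp
next
  case (insert b T)
  then obtain \<kappa> where \<kappa>: "\<And>g. \<exists>c. \<forall>t\<in>T. g t = (\<Sum>i<card T. c i * relu (t - \<kappa> i))"
    by blast
  obtain m where m: "m < b" "\<And>t. t \<in> T \<Longrightarrow> t \<le> m"
  proof (cases "T = {}")
    case True
    then show ?thesis using that[of "b - 1"] by simp
  next
    case False
    then show ?thesis using that[of "Max T"] insert.hyps by simp
  qed
  have card: "card (insert b T) = Suc (card T)" using insert.hyps by auto
  let ?\<kappa> = "\<kappa>(card T := m)"
  have "\<exists>c. \<forall>t\<in>insert b T. g t = (\<Sum>i<card (insert b T). c i * relu (t - ?\<kappa> i))" for g
  proof -
    obtain c where c: "\<forall>t\<in>T. g t = (\<Sum>i<card T. c i * relu (t - \<kappa> i))" using \<kappa> by blast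
    let ?a = "(g b - (\<Sum>i<card T. c i * relu (b - \<kappa> i))) / (b - m)"
    have "g t = (\<Sum>i<card (insert b T). (c(card T := ?a)) i * relu (t - ?\<kappa> i))"
      if "t \<in> insert b T" for t
    proof -
      have "(\<Sum>i<card (insert b T). (c(card T := ?a)) i * relu (t - ?\<kappa> i))
          = (\<Sum>i<card T. c i * relu (t - \<kappa> i)) + ?a * relu (t - m)"
        unfolding card by simp
      also have "\<dots> = g t"
      proof (cases "t = b")
        case True
        then show ?thesis using m(1) by (simp add: relu_def)
      next
        case False
        then show ?thesis using that c m(2)[of t] by (simp add: relu_def)
      qed
      finally show ?thesis by simp
    qed
    then show ?thesis by blast
  qed
  then show ?case by blast
qed

section \<open>Evaluating ReLU sums by a deep network\<close>

text \<open>This evaluates an accumulator row of a hidden layer: copy component \<open>a\<close>,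
  add a multiple of component \<open>p\<close>. The case \<open>n \<le> a\<close> arises where the
  width grows and the accumulator has no predecessor.\<close>

lemma sum_mult_delta_plus:
  fixes z :: "nat \<Rightarrow> real"
  assumes "p < n" "p \<noteq> a"
  shows "(\<Sum>b\<in>{0..<n}. (if b = a then 1 else if b = p then e else 0) * z b)
    = (if a < n then z a else 0) + e * z p"
proof -
  have "(if b = a then 1 else if b = p then e else 0) * z b
      = (if b = a then z b else 0) + (if b = p then e * z b else 0)" for b
    using assms(2) by simp
  then show ?thesis using assms(1) by (simp add: sum.distrib)
qed

definition interpolant_arch :: "nat \<Rightarrow> nat \<Rightarrow> nat \<Rightarrow> nat \<Rightarrow> nat list" where
  "interpolant_arch d r m N = [d, 4, 4] @ replicate (2 * m - 2) (2 * r + 4) @ [N]"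

text \<open>
  The hidden state at layer \<open>l\<close> is \<open>(t, t - \<kappa> l, S\<^sub>0, S\<^sub>1, \<dots>)\<close>, where \<open>S\<^sub>j\<close> accumulates
  \<open>e j i * relu (t - \<kappa> i)\<close> over \<open>i < l\<close>. Since the weights \<open>e\<close> and \<open>t\<close> are nonnegative, ReLU changes
  only the component \<open>t - \<kappa> l\<close>. The condition \<open>e j 0 = 0\<close> accounts for the width 4 of the first two
  hidden layers, which have no room for the accumulators from \<open>S\<^sub>2\<close> on.
\<close>

definition hidden_state ::
  "(nat \<Rightarrow> real) \<Rightarrow> (nat \<Rightarrow> nat \<Rightarrow> real) \<Rightarrow> real \<Rightarrow> nat \<Rightarrow> nat \<Rightarrow> real" where
  "hidden_state \<kappa> e t l a = (if a = 0 then t else if a = 1 then t - \<kappa> l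
     else \<Sum>i<l. e (a - 2) i * relu (t - \<kappa> i))"

text \<open>Output \<open>k\<close> is the difference of the accumulators \<open>k\<close> and
  \<open>r + k\<close>, formed by the affine last layer. There are \<open>2 * m\<close> hidden
  layers, and the state of the last one, with index \<open>2 * m - 1\<close>, has collected the
  first \<open>2 * m - 1\<close> knots. Inputs with a negative affine value are excluded since ReLU
  would not pass that value on unchanged.\<close>

lemma relu_network_accumulates:
  fixes w \<kappa> :: "nat \<Rightarrow> real" and e :: "nat \<Rightarrow> nat \<Rightarrow> real"
  assumes m: "2 \<le> m" and e: "\<And>j i. 0 \<le> e j i" and e0: "\<And>j. e j 0 = 0"
  shows "\<exists>\<mu>\<in>net_params (interpolant_arch d r m N). \<forall>v. 0 \<le> (\<Sum>b<d. w b * v b) + \<beta> \<longrightarrow>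
    network relu \<mu> (vec d v) = vec N (\<lambda>k. if k < r then
      (\<Sum>i<2*m-1. (e k i - e (r + k) i) * relu ((\<Sum>b<d. w b * v b) + \<beta> - \<kappa> i)) else 0)"
proof -
  define n where "n l = interpolant_arch d r m N ! l" for l
  define W0 where "W0 = mat 4 d (\<lambda>(a, b). if a < 2 then w b else 0)"
  define b0 where "b0 = vec 4 (\<lambda>a. if a = 0 then \<beta> else if a = 1 then \<beta> - \<kappa> 0 else 0)"
  \<comment> \<open>\<open>W l\<close> leads from state \<open>l - 1\<close> to state
    \<open>l\<close>. Rows 0 and 1 both copy \<open>t\<close>, and \<open>bias l\<close> turns the
    second copy into \<open>t - \<kappa> l\<close>. The other rows read component 1 of the previous
    state, whose knot is \<open>\<kappa> (l - 1)\<close>; hence the weight index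
    \<open>l - 1\<close>.\<close>
  define W :: "nat \<Rightarrow> real mat" where "W l = mat (n (l + 1)) (n l)
     (\<lambda>(a, b). if a < 2 then (if b = 0 then 1 else 0)
     else if b = a then 1 else if b = 1 then e (a - 2) (l - 1) else 0)" for l
  define bias where "bias l = vec (n (l + 1)) (\<lambda>a. if a = 1 then - \<kappa> l else 0)" for l
  define W1 :: "real mat" where "W1 = mat N (2 * r + 4) (\<lambda>(k, b). if k < r then
     (if b = k + 2 then 1 else 0) - (if b = r + k + 2 then 1 else 0) else 0)"
  define \<mu> where "\<mu> = map (\<lambda>l. if l = 0 then (W0, b0) else if l < 2 * m then (W l, bias l)
     else (W1, 0\<^sub>v N)) [0..<2*m+1]"
  have n0: "n 0 = d" and n1: "n (Suc 0) = 4" and n2: "n (Suc (Suc 0)) = 4"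
    and n3: "\<And>l. 3 \<le> l \<Longrightarrow> l \<le> 2 * m \<Longrightarrow> n l = 2 * r + 4" and nN: "n (2 * m + 1) = N"
    using m by (auto simp: n_def interpolant_arch_def nth_append nth_Cons' numeral_eq_Suc)
  have len: "length \<mu> = 2 * m + 1" by (simp add: \<mu>_def)
  have \<mu>0: "\<mu> ! 0 = (W0, b0)" using m by (simp add: \<mu>_def del: upt_Suc)
  have \<mu>l: "\<mu> ! l = (W l, bias l)" if "0 < l" "l < 2 * m" for l
    using that by (simp add: \<mu>_def del: upt_Suc)
  have \<mu>N: "\<mu> ! (2 * m) = (W1, 0\<^sub>v N)" using m by (simp add: \<mu>_def del: upt_Suc)
  have n4: "4 \<le> n l" if "1 \<le> l" "l \<le> 2 * m" for l
    using that n1 n2 n3[of l] by (cases "l = 1"; cases "l = 2") (auto simp: numeral_eq_Suc)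
  have "\<mu> \<in> net_params (interpolant_arch d r m N)"
    unfolding net_params_def
  proof (intro CollectI conjI allI impI)
    show "length (interpolant_arch d r m N) = length \<mu> + 1"
      using m by (simp add: len interpolant_arch_def)
  next
    fix l assume "l < length \<mu>"
    then consider "l = 0" | "0 < l" "l < 2 * m" | "l = 2 * m"
      by (cases "l = 0"; cases "l = 2 * m") (auto simp: len)
    then have "fst (\<mu> ! l) \<in> carrier_mat (n (l + 1)) (n l) \<and> snd (\<mu> ! l) \<in> carrier_vec (n (l + 1))"
    proof cases
      case 1 then show ?thesis using n0 n1 by (simp add: \<mu>0 W0_def b0_def)
    next
      case 2 then show ?thesis by (simp add: \<mu>l W_def bias_def)
    next
      case 3 then show ?thesis using n3[of l] nN m by (simp add: \<mu>N W1_def)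
    qed
    then show "fst (\<mu> ! l) \<in> carrier_mat (interpolant_arch d r m N ! (l + 1)) (interpolant_arch d r m N ! l)"
      and "snd (\<mu> ! l) \<in> carrier_vec (interpolant_arch d r m N ! (l + 1))"
      by (simp_all add: n_def)
  qed
  moreover have "network relu \<mu> (vec d v) = vec N (\<lambda>k. if k < r then
      (\<Sum>i<2*m-1. (e k i - e (r + k) i) * relu ((\<Sum>b<d. w b * v b) + \<beta> - \<kappa> i)) else 0)"
    if pos: "0 \<le> (\<Sum>b<d. w b * v b) + \<beta>" for v
  proof -
    define t where "t = (\<Sum>b<d. w b * v b) + \<beta>"
    have t: "0 \<le> t" using pos by (simp add: t_def)
    have acc_nonneg: "0 \<le> hidden_state \<kappa> e t l a" if "a \<noteq> 1" for l a
      using that t e by (auto simp: hidden_state_def relu_def intro!: sum_nonneg mult_nonneg_nonneg)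
    then have acc_relu: "relu (hidden_state \<kappa> e t l a) = hidden_state \<kappa> e t l a" if "a \<noteq> 1" for l a
      using that by (simp add: relu_def)
    have layer: "net_layer relu \<mu> (vec d v) l = vec (n (l + 1)) (hidden_state \<kappa> e t l)"
      if "l < 2 * m" for l
      using that
    proof (induction l)
      case 0
      show ?case
      proof (rule eq_vecI)
        fix a assume "a < dim_vec (vec (n (0 + 1)) (hidden_state \<kappa> e t 0))"
        then have a: "a < 4" using n1 by simp
        show "net_layer relu \<mu> (vec d v) 0 $ a = vec (n (0 + 1)) (hidden_state \<kappa> e t 0) $ a"
          using a n1
          by (auto simp: \<mu>0 W0_def b0_def scalar_prod_def hidden_state_def t_def atLeast0LessThan)
      qed (use n1 in \<open>simp add: \<mu>0 W0_def b0_def\<close>)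
    next
      case (Suc l)
      then have IH: "net_layer relu \<mu> (vec d v) l = vec (n (l + 1)) (hidden_state \<kappa> e t l)" by simp
      have \<mu>S: "\<mu> ! Suc l = (W (Suc l), bias (Suc l))" using \<mu>l Suc.prems by simp
      show ?case
      proof (rule eq_vecI)
        fix a assume "a < dim_vec (vec (n (Suc l + 1)) (hidden_state \<kappa> e t (Suc l)))"
        then have a: "a < n (Suc (Suc l))" by simp
        have big: "4 \<le> n (Suc l)" using n4[of "Suc l"] Suc.prems by simp
        have "net_layer relu \<mu> (vec d v) (Suc l) $ a
            = (\<Sum>b\<in>{0..<n (Suc l)}. W (Suc l) $$ (a, b) * relu (hidden_state \<kappa> e t l b))
              + bias (Suc l) $ a"
          using a by (simp add: \<mu>S IH W_def bias_def scalar_prod_def)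
        also have "\<dots> = hidden_state \<kappa> e t (Suc l) a"
        proof (cases "a < 2")
          case True
          have "(\<Sum>b\<in>{0..<n (Suc l)}. W (Suc l) $$ (a, b) * relu (hidden_state \<kappa> e t l b))
              = (\<Sum>b\<in>{0..<n (Suc l)}. if b = 0 then relu (hidden_state \<kappa> e t l b) else 0)"
            using a True by (intro sum.cong) (auto simp: W_def)
          also have "\<dots> = t" using big acc_relu[of 0] by (simp add: hidden_state_def)
          finally show ?thesis using True a by (auto simp: bias_def hidden_state_def)
        next
          case False
          have "(\<Sum>b\<in>{0..<n (Suc l)}. W (Suc l) $$ (a, b) * relu (hidden_state \<kappa> e t l b))
              = (\<Sum>b\<in>{0..<n (Suc l)}. (if b = a then 1 else if b = 1 then e (a - 2) l else 0)
                  * relu (hidden_state \<kappa> e t l b))"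
            using a False by (intro sum.cong) (auto simp: W_def)
          also have "\<dots> = (if a < n (Suc l) then relu (hidden_state \<kappa> e t l a) else 0)
              + e (a - 2) l * relu (hidden_state \<kappa> e t l 1)"
            using big False by (intro sum_mult_delta_plus) auto
          also have "relu (hidden_state \<kappa> e t l 1) = relu (t - \<kappa> l)" by (simp add: hidden_state_def)
          also have "(if a < n (Suc l) then relu (hidden_state \<kappa> e t l a) else 0)
              = (\<Sum>i<l. e (a - 2) i * relu (t - \<kappa> i))"
          proof (cases "a < n (Suc l)")
            case True
            then show ?thesis using False acc_relu[of a l] by (simp add: hidden_state_def)
          next
            \<comment> \<open>Accumulator \<open>a\<close> is new in this layer. The width can grow
              only directly after the two layers of width 4, so the old sum has at most the term
              \<open>i = 0\<close>, which \<open>e0\<close> makes zero.\<close>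
            case small: False
            have "l \<le> 1"
            proof (rule ccontr)
              assume "\<not> l \<le> 1"
              then have "n (Suc l) = n (Suc (Suc l))" using n3 Suc.prems by simp
              with small a show False by simp
            qed
            then show ?thesis using small e0 by (cases l) auto
          qed
          finally show ?thesis using False a by (simp add: bias_def hidden_state_def)
        qed
        finally show "net_layer relu \<mu> (vec d v) (Suc l) $ a
            = vec (n (Suc l + 1)) (hidden_state \<kappa> e t (Suc l)) $ a"
          using a by simp
      qed (simp add: \<mu>S bias_def)
    qed
    have last: "net_layer relu \<mu> (vec d v) (2 * m - 1) = vec (2 * r + 4) (hidden_state \<kappa> e t (2 * m - 1))"
      using layer[of "2 * m - 1"] n3[of "2 * m"] m by simp
    have "2 * m = Suc (2 * m - 1)" using m by simp
    then have "network relu \<mu> (vec d v)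
        = W1 *\<^sub>v map_vec relu (vec (2 * r + 4) (hidden_state \<kappa> e t (2 * m - 1))) + 0\<^sub>v N"
      using \<mu>N last unfolding network_def len by (metis add_diff_cancel_right' fst_conv snd_conv net_layer.simps(2))
    also have "\<dots> = vec N (\<lambda>k. if k < r then
        (\<Sum>i<2*m-1. (e k i - e (r + k) i) * relu (t - \<kappa> i)) else 0)" (is "?l = ?r")
    proof (rule eq_vecI)
      fix k assume "k < dim_vec ?r"
      then have k: "k < N" by simp
      have "?l $ k = (\<Sum>b\<in>{0..<2*r+4}. W1 $$ (k, b) * relu (hidden_state \<kappa> e t (2 * m - 1) b))"
        using k by (simp add: W1_def scalar_prod_def)
      also have "\<dots> = ?r $ k"
      proof (cases "k < r")
        case True
        let ?z = "\<lambda>b. relu (hidden_state \<kappa> e t (2 * m - 1) b)"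
        have "(\<Sum>b\<in>{0..<2*r+4}. W1 $$ (k, b) * ?z b)
            = (\<Sum>b\<in>{0..<2*r+4}. (if b = k + 2 then ?z b else 0) - (if b = r + k + 2 then ?z b else 0))"
          using k True by (intro sum.cong) (auto simp: W1_def)
        also have "\<dots> = ?z (k + 2) - ?z (r + k + 2)"
          using True by (simp add: sum_subtractf)
        also have "\<dots> = (\<Sum>i<2*m-1. (e k i - e (r + k) i) * relu (t - \<kappa> i))"
          using acc_relu[of "k + 2" "2*m-1"] acc_relu[of "r + k + 2" "2*m-1"]
          by (simp add: hidden_state_def left_diff_distrib sum_subtractf)
        finally show ?thesis using k True by simp
      next
        case False
        then show ?thesis using k by (simp add: W1_def)
      qed
      finally show "?l $ k = ?r $ k" .
    qed (simp add: W1_def)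
    finally show ?thesis unfolding t_def .
  qed
  ultimately show ?thesis by blast
qed

section \<open>Interpolation at the sample points\<close>

lemma relu_network_interpolates:
  fixes Y :: "(nat \<Rightarrow> real) set" and g :: "nat \<Rightarrow> (nat \<Rightarrow> real) \<Rightarrow> real"
  assumes fin: "finite Y" and card: "card Y \<le> m" and m: "2 \<le> m"
    and supp: "\<And>v i. v \<in> Y \<Longrightarrow> d \<le> i \<Longrightarrow> v i = 0"
  shows "\<exists>\<mu>\<in>net_params (interpolant_arch d r m N). \<forall>v\<in>Y.
    network relu \<mu> (vec d v) = vec N (\<lambda>k. if k < r then g k v else 0)"
proof -
  obtain w where w: "inj_on (\<lambda>v. \<Sum>b<d. w b * v b) Y"
    using separating_direction[of Y d] fin supp by blast
  \<comment> \<open>A shift by the sum of all absolute values makes \<open>t\<close> nonnegative on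
    the whole of \<open>Y\<close>.\<close>
  define \<beta> where "\<beta> = (\<Sum>v\<in>Y. \<bar>\<Sum>b<d. w b * v b\<bar>)"
  define t where "t v = (\<Sum>b<d. w b * v b) + \<beta>" for v
  have inj: "inj_on t Y" using w by (auto simp: inj_on_def t_def)
  have pos: "0 \<le> t v" if "v \<in> Y" for v
  proof -
    have "\<bar>\<Sum>b<d. w b * v b\<bar> \<le> \<beta>"
      unfolding \<beta>_def using that fin by (intro member_le_sum) auto
    then show ?thesis by (simp add: t_def)
  qed
  have cardT: "card (t ` Y) = card Y" using card_image[OF inj] .
  obtain \<kappa> where \<kappa>: "\<And>g. \<exists>c. \<forall>s\<in>t ` Y. g s = (\<Sum>i<card Y. c i * relu (s - \<kappa> i))"
    using relu_interpolation[of "t ` Y"] fin cardT by auto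
  have "\<exists>c. \<forall>v\<in>Y. g k v = (\<Sum>i<card Y. c i * relu (t v - \<kappa> i))" for k
    using \<kappa>[of "\<lambda>s. g k (the_inv_into Y t s)"] the_inv_into_f_f[OF inj] by auto
  then obtain c where c: "\<And>k v. v \<in> Y \<Longrightarrow> g k v = (\<Sum>i<card Y. c k i * relu (t v - \<kappa> i))"
    by metis
  \<comment> \<open>Coefficients and knots move up by one index, which leaves weight 0 at index 0 as
    the narrow layers require.\<close>
  define c' where "c' k i = (if 0 < i \<and> i \<le> card Y then c k (i - 1) else 0)" for k i
  \<comment> \<open>Accumulators below \<open>r\<close> take the positive parts, those from
    \<open>r\<close> on the negative parts.\<close>
  define e where "e j i = (if j < r then max (c' j i) 0 else max (- c' (j - r) i) 0)" for j i
  have "e j 0 = 0" for j by (simp add: e_def c'_def)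
  moreover have "0 \<le> e j i" for j i by (simp add: e_def)
  ultimately obtain \<mu> where \<mu>: "\<mu> \<in> net_params (interpolant_arch d r m N)"
    and net: "\<And>v. 0 \<le> t v \<Longrightarrow> network relu \<mu> (vec d v) = vec N (\<lambda>k. if k < r then
      (\<Sum>i<2*m-1. (e k i - e (r + k) i) * relu (t v - \<kappa> (i - 1))) else 0)"
    using relu_network_accumulates[OF m, of e d r N w \<beta> "\<lambda>i. \<kappa> (i - 1)"] unfolding t_def by blast
  have "(\<Sum>i<2*m-1. (e k i - e (r + k) i) * relu (t v - \<kappa> (i - 1))) = g k v"
    if "v \<in> Y" "k < r" for k v
  proof -
    have "(\<Sum>i<2*m-1. (e k i - e (r + k) i) * relu (t v - \<kappa> (i - 1)))
        = (\<Sum>i<2*m-1. c' k i * relu (t v - \<kappa> (i - 1)))"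
      using that(2) by (intro sum.cong) (auto simp: e_def max_def)
    \<comment> \<open>The shifted sum needs \<open>card Y + 1\<close> indices, and
      \<open>m + 1 \<le> 2 * m - 1\<close> because \<open>2 \<le> m\<close>.\<close>
    also have "\<dots> = (\<Sum>i<Suc (card Y). c' k i * relu (t v - \<kappa> (i - 1)))"
      using card m by (intro sum.mono_neutral_right) (auto simp: c'_def)
    also have "\<dots> = (\<Sum>i<card Y. c k i * relu (t v - \<kappa> i))"
      by (subst sum.lessThan_Suc_shift) (simp add: c'_def)
    finally show ?thesis using c[OF that(1)] by simp
  qed
  then show ?thesis using \<mu> net pos by (intro bexI[of _ \<mu>] ballI) (auto intro!: eq_vecI)
qed

section \<open>Zero loss for the operator network\<close>

lemma entry_norm_zero_mat: "entry_norm p (0\<^sub>m m n) = 0"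
  by (simp add: entry_norm_def)

theorem theorem3p6:
  fixes p :: real
    and N K mx my d r :: nat
    and \<Omega> :: "(nat \<Rightarrow> real) set"
    and \<sigma> :: "real \<Rightarrow> real"
    and branch_arch trunk_arch :: "nat list"
    and f :: "nat \<Rightarrow> real vec"
    and y :: "nat \<Rightarrow> nat \<Rightarrow> real"
    and u :: "nat \<Rightarrow> (nat \<Rightarrow> real) \<Rightarrow> real"
    and U :: "real mat"
    and \<Phi> C :: "net_param \<Rightarrow> real mat"
  assumes "1 \<le> p"
    and "0 < N" and "0 < K" and "0 < mx" and "0 < my" and "N < my"
    and "compactin (Euclidean_space d) \<Omega>"
    and "\<And>i. i < my \<Longrightarrow> y i \<in> \<Omega>"
    and "\<And>k. k < K \<Longrightarrow> f k \<in> carrier_vec mx"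
    and U: "U = output_mat my K y u"
    and \<Phi>: "\<Phi> = trunk_mat d N my y"
    and C: "C = branch_mat \<sigma> N K f"
    and r: "r = vec_space.rank my U"
    and "r \<le> N"
    and trunk_arch:
      "trunk_arch = [d, 4, 4] @ replicate (2 * my - 2) (2 * min N r + 4) @ [N]"
    and "2 \<le> length branch_arch" and "hd branch_arch = mx" and "last branch_arch = N + 1"
    and "\<forall>M \<in> carrier_mat (N + 1) K. \<exists>\<theta> \<in> net_params branch_arch. C \<theta> = M"
  shows "\<exists>(\<mu>, \<theta>) \<in> net_params trunk_arch \<times> net_params branch_arch.
      is_arg_min (\<lambda>(\<mu>, \<theta>). entry_norm p (\<Phi> \<mu> * C \<theta> - U) powr p)
        (\<lambda>z. z \<in> net_params trunk_arch \<times> net_params branch_arch) (\<mu>, \<theta>) \<and>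
      entry_norm p (\<Phi> \<mu> * C \<theta> - U) powr p = 0"
proof -
  have U_carr: "U \<in> carrier_mat my K" by (simp add: U output_mat_def)
  obtain g c where g: "\<And>j. j < r \<Longrightarrow> g j < K"
    and factor: "\<And>i k. i < my \<Longrightarrow> k < K \<Longrightarrow> U $$ (i, k) = (\<Sum>j<r. c j k * U $$ (i, g j))"
    using vec_space.rank_factorization[OF U_carr] unfolding r by blast
  let ?Y = "y ` {..<my}"
  have my: "2 \<le> my" using assms(2,6) by simp
  have arch: "trunk_arch = interpolant_arch d r my N"
    using trunk_arch \<open>r \<le> N\<close> by (simp add: interpolant_arch_def min_absorb2)
  have "card ?Y \<le> my" using card_image_le[of "{..<my}" y] by simp
  moreover have "v b = 0" if "v \<in> ?Y" "d \<le> b" for v b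
    using assms(7,8) that by (auto simp: compactin_def topspace_Euclidean_space)
  ultimately obtain \<mu> where \<mu>: "\<mu> \<in> net_params trunk_arch"
    and net: "\<And>i. i < my \<Longrightarrow> network relu \<mu> (vec d (y i))
      = vec N (\<lambda>k. if k < r then u (g k) (y i) else 0)"
    using relu_network_interpolates[of ?Y my d r N "\<lambda>k. u (g k)"] my unfolding arch by auto
  \<comment> \<open>Row 0 is zero and cancels the constant trunk component 1; this shifts the
    coefficients of the factorization by one row. The rows after row \<open>r\<close> meet trunk
    outputs that are zero at the sample points.\<close>
  define M where "M = mat (N + 1) K (\<lambda>(j, k). if 0 < j \<and> j \<le> r then c (j - 1) k else 0)"
  have "M \<in> carrier_mat (N + 1) K" by (simp add: M_def)
  then obtain \<theta> where \<theta>: "\<theta> \<in> net_params branch_arch" and C\<theta>: "C \<theta> = M" using assms(19) by blast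
  have "\<Phi> \<mu> * C \<theta> = U"
  proof (rule eq_matI)
    fix i k assume "i < dim_row U" "k < dim_col U"
    then have ik: "i < my" "k < K" using U_carr by auto
    have "(\<Phi> \<mu> * C \<theta>) $$ (i, k) = (\<Sum>j\<in>{0..<Suc N}. \<Phi> \<mu> $$ (i, j) * M $$ (j, k))"
      using ik by (simp add: C\<theta> \<Phi> trunk_mat_def M_def scalar_prod_def)
    also have "\<dots> = (\<Sum>j<N. \<Phi> \<mu> $$ (i, Suc j) * M $$ (Suc j, k))"
      using ik by (simp add: atLeast0LessThan sum.lessThan_Suc_shift M_def del: sum.lessThan_Suc)
    also have "\<dots> = (\<Sum>j<N. if j < r then c j k * U $$ (i, g j) else 0)"
      using ik g by (intro sum.cong)
        (auto simp: \<Phi> trunk_mat_def trunk_def net M_def U output_mat_def)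
    also have "\<dots> = (\<Sum>j<r. c j k * U $$ (i, g j))"
      using \<open>r \<le> N\<close> by (intro sum.mono_neutral_cong_right) auto
    also have "\<dots> = U $$ (i, k)" using factor ik by simp
    finally show "(\<Phi> \<mu> * C \<theta>) $$ (i, k) = U $$ (i, k)" .
  qed (use U_carr in \<open>auto simp: \<Phi> trunk_mat_def C\<theta> M_def\<close>)
  then have "entry_norm p (\<Phi> \<mu> * C \<theta> - U) powr p = 0"
    using U_carr by (simp add: entry_norm_zero_mat)
  \<comment> \<open>The objective is a value of \<open>powr\<close>, hence nonnegative everywhere,
    so the value 0 is minimal.\<close>
  then show ?thesis using \<mu> \<theta> by (intro bexI[of _ "(\<mu>, \<theta>)"]) (auto simp: is_arg_min_def not_less)
qed

end
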